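(* There exist a constant $c>0$ and an integer $N$ such that for every integer $n\ge N$ there is a bipartite graph $G$ on $n$ vertices with the following property: for every difference graph cover $\mathcal{H}$ of $G$, there is a vertex of $G$ that appears in at least $c\,n/\log n$ of the graphs in $\mathcal{H}$.
   Context: Graphs are finite and simple; $[k]=\{1,\dots,k\}$. A difference graph $H(a,b;f)$ ($a,b\ge 1$) is a bipartite graph on $a+b$ vertices with partite sets $U=\{u_1,\dots,u_a\}$ and $W=\{w_1,\dots,w_b\}$, together with a non-increasing function $f:[a]\to[b]$ with $f(1)=b$, such that $N(u_i)=\{w_1,\dots,w_{f(i)}\}$ for all $i\in[a]$. (In particular, there are no isolated vertices.) A difference graph cover of a graph $G$ is a family $\mathcal{H}$ of subgraphs of $G$, each of which is (isomorphic to) a difference graph, such that $E(G)=\bigcup_{H\in\mathcal{H}}E(H)$. *)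

theory Defs
  imports Complex_Main "Graph_Theory.Graph_Theory"
begin

text \<open>
  A finite simple graph is a \<^const>\<open>pair_graph\<close>: a finite, loop-free, symmetric digraph whose
  arcs are pairs of vertices, so that an edge \<open>uv\<close> appears as the two arcs \<open>(u, v)\<close> and
  \<open>(v, u)\<close>.
\<close>

definition bipartite :: "'a pair_pre_digraph \<Rightarrow> bool" where
  "bipartite G \<longleftrightarrow>
    (\<exists>U W. pverts G = U \<union> W \<and> U \<inter> W = {} \<and> parcs G \<subseteq> U \<times> W \<union> W \<times> U)"

text \<open>The vertex \<open>u\<^sub>i\<close> is \<^term>\<open>Inl i\<close> and the vertex \<open>w\<^sub>j\<close> is \<^term>\<open>Inr j\<close>.\<close>

definition diff_graph :: "nat \<Rightarrow> nat \<Rightarrow> (nat \<Rightarrow> nat) \<Rightarrow> (nat + nat) pair_pre_digraph" where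
  "diff_graph a b f =
    \<lparr> pverts = Inl ` {1..a} \<union> Inr ` {1..b},
      parcs = (\<Union>i\<in>{1..a}. \<Union>j\<in>{1..f i}. {(Inl i, Inr j), (Inr j, Inl i)}) \<rparr>"

definition diff_fun :: "nat \<Rightarrow> nat \<Rightarrow> (nat \<Rightarrow> nat) \<Rightarrow> bool" where
  "diff_fun a b f \<longleftrightarrow> f \<in> {1..a} \<rightarrow> {1..b} \<and> antimono_on {1..a} f \<and> f 1 = b"

definition is_difference_graph :: "'a pair_pre_digraph \<Rightarrow> bool" where
  "is_difference_graph H \<longleftrightarrow>
    (\<exists>a b f. a \<ge> 1 \<and> b \<ge> 1 \<and> diff_fun a b f \<and>
      digraph_iso (with_proj H) (with_proj (diff_graph a b f)))"

definition difference_graph_cover ::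
    "'a pair_pre_digraph \<Rightarrow> 'a pair_pre_digraph set \<Rightarrow> bool" where
  "difference_graph_cover G \<H> \<longleftrightarrow>
    (\<forall>H\<in>\<H>. subgraph (with_proj H) (with_proj G) \<and> is_difference_graph H) \<and>
    parcs G = (\<Union>H\<in>\<H>. parcs H)"

lemma pair_graph_diff_graph:
  assumes "diff_fun a b f"
  shows "pair_graph (diff_graph a b f)"
  by unfold_locales
    (use assms in \<open>auto simp: diff_graph_def diff_fun_def symmetric_def sym_def Pi_def\<close>)

text \<open>
  Members of a cover are symmetric, i.e. subgraphs in the undirected sense, as this property
  is inherited through the isomorphism.
\<close>

lemma pair_graph_difference_graph:
  assumes "is_difference_graph H"
  shows "pair_graph H"
proof -
  obtain a b f h where f: "diff_fun a b f"
    and h: "pre_digraph.digraph_isomorphism (with_proj H) h"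
    and eq: "with_proj (diff_graph a b f) = app_iso h (with_proj H)"
    using assms by (auto simp: is_difference_graph_def digraph_iso_def)
  interpret D: pair_graph "diff_graph a b f" by (rule pair_graph_diff_graph[OF f])
  let ?v = "iso_verts h"
  have V: "pverts (diff_graph a b f) = ?v ` pverts H"
    and A: "parcs (diff_graph a b f) = iso_arcs h ` parcs H"
    and T: "iso_tail h = fst" "iso_head h = snd"
    using eq by (auto simp: with_proj_def app_iso_def)
  interpret W: wf_digraph "with_proj H"
    using h by (simp add: pre_digraph.digraph_isomorphism_def)
  have iv: "inj_on ?v (pverts H)" and ia: "inj_on (iso_arcs h) (parcs H)"
    and arc: "\<And>x y. (x, y) \<in> parcs H \<Longrightarrow> iso_arcs h (x, y) = (?v x, ?v y)"
    using h T by (auto simp: pre_digraph.digraph_isomorphism_def prod_eq_iff)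
  have wf: "x \<in> pverts H" "y \<in> pverts H" if "(x, y) \<in> parcs H" for x y
    using that W.tail_in_verts W.head_in_verts by force+
  show ?thesis
  proof
    show "fst e \<in> pverts H" "snd e \<in> pverts H" if "e \<in> parcs H" for e
      using that wf by (cases e; auto)+
    show "finite (pverts H)"
      using D.pair_finite_verts V iv by (simp add: finite_image_iff)
    show "finite (parcs H)"
      using D.pair_finite_arcs A ia by (simp add: finite_image_iff)
    show "fst e \<noteq> snd e" if "e \<in> parcs H" for e
    proof -
      have "iso_arcs h e \<in> parcs (diff_graph a b f)" using that A by simp
      moreover have "iso_arcs h e = (?v (fst e), ?v (snd e))"
        using arc[of "fst e" "snd e"] that by simp
      ultimately show ?thesis using D.pair_no_loops by fastforce
    qed
    have "(y, x) \<in> parcs H" if xy: "(x, y) \<in> parcs H" for x y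
    proof -
      have "(?v x, ?v y) \<in> parcs (diff_graph a b f)"
        using xy A arc by (metis imageI)
      then have "(?v y, ?v x) \<in> iso_arcs h ` parcs H"
        using D.pair_sym_arcs unfolding A[symmetric] by (simp add: symmetric_def symD)
      then obtain p q where pq: "(p, q) \<in> parcs H" "?v p = ?v y" "?v q = ?v x"
        using arc by auto
      have "p = y" "q = x"
        using inj_onD[OF iv pq(2)] inj_onD[OF iv pq(3)] wf[OF xy] wf[OF pq(1)] by simp_all
      with pq show ?thesis by simp
    qed
    then show "symmetric (with_proj H)" by (auto simp: symmetric_def sym_def)
  qed
qed

end

theory Submission
  imports Defs
begin

text \<open>
  The proof counts labelled graphs.  In a difference graph, label \<open>u\<^sub>i\<close> with its side and
  \<open>f i\<close>, and \<open>w\<^sub>j\<close> with its side and \<open>j\<close>: two vertices are adjacent iff their sides differ and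
  their numbers compare the right way.  Hence a graph on \<open>n\<close> vertices that has a cover in which
  every vertex appears in at most \<open>k\<close> members is determined by assigning to each vertex at most
  \<open>k\<close> triples (name of the member, side, number), each of which can be chosen in \<open>n\<^bsup>O(1)\<^esup>\<close>
  ways.  So there are only \<open>exp (O (n k log n))\<close> such graphs, while a bipartition into halves
  carries at least \<open>2\<^bsup>(n\<^sup>2 - 1) / 4\<^esup>\<close> bipartite graphs.
\<close>

section \<open>Labels of vertices in a difference graph\<close>

text \<open>\<open>True\<close> marks the side of the \<open>u\<^sub>i\<close>. Either branch asks
  that the number on the \<open>False\<close> side be at most the one on the \<open>True\<close>
  side, so the relation is symmetric, as the arcs are.\<close>

definition label_adj :: "bool \<times> nat \<Rightarrow> bool \<times> nat \<Rightarrow> bool" where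
  "label_adj p q \<longleftrightarrow> fst p \<noteq> fst q \<and> (if fst p then snd q \<le> snd p else snd p \<le> snd q)"

lemma card_diff_graph_verts: "card (pverts (diff_graph a b f)) = a + b"
  unfolding diff_graph_def by (simp, subst card_Un_disjoint) (auto simp: card_image)

text \<open>The labels of the standard model are pulled back along the isomorphism, whose
  injectivity on vertices makes arcs correspond in both directions. The bound on the numbers is
  crude, but polynomial size is enough for the count.\<close>

lemma difference_graph_labelling:
  assumes "is_difference_graph H"
  obtains s where "\<And>x. x \<in> pverts H \<Longrightarrow> snd (s x) \<le> card (pverts H)"
    and "\<And>x y. x \<in> pverts H \<Longrightarrow> y \<in> pverts H \<Longrightarrow> (x, y) \<in> parcs H \<longleftrightarrow> label_adj (s x) (s y)"
proof -
  obtain a b f h where f: "diff_fun a b f"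
    and h: "pre_digraph.digraph_isomorphism (with_proj H) h"
    and eq: "with_proj (diff_graph a b f) = app_iso h (with_proj H)"
    using assms by (auto simp: is_difference_graph_def digraph_iso_def)
  let ?v = "iso_verts h" and ?D = "diff_graph a b f"
  have V: "pverts ?D = ?v ` pverts H"
    and A: "parcs ?D = iso_arcs h ` parcs H"
    and T: "iso_tail h = fst" "iso_head h = snd"
    using eq by (auto simp: with_proj_def app_iso_def)
  have iv: "inj_on ?v (pverts H)"
    and arc: "\<And>x y. (x, y) \<in> parcs H \<Longrightarrow> iso_arcs h (x, y) = (?v x, ?v y)"
    using h T by (auto simp: pre_digraph.digraph_isomorphism_def prod_eq_iff)
  interpret H: pair_graph H by (rule pair_graph_difference_graph[OF assms])
  have arcs_iff: "(x, y) \<in> parcs H \<longleftrightarrow> (?v x, ?v y) \<in> parcs ?D"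
    if "x \<in> pverts H" "y \<in> pverts H" for x y
  proof
    assume "(x, y) \<in> parcs H"
    then show "(?v x, ?v y) \<in> parcs ?D" using A arc by (metis imageI)
  next
    assume "(?v x, ?v y) \<in> parcs ?D"
    then obtain p q where pq: "(p, q) \<in> parcs H" "?v p = ?v x" "?v q = ?v y"
      using A arc by auto
    have "p \<in> pverts H" "q \<in> pverts H" using H.wellformed' pq(1) by auto
    then have "p = x" "q = y"
      using inj_onD[OF iv pq(2)] inj_onD[OF iv pq(3)] that by simp_all
    with pq show "(x, y) \<in> parcs H" by simp
  qed
  define lab where "lab = case_sum (\<lambda>i. (True, f i)) (\<lambda>j. (False, j))"
  have card: "card (pverts H) = a + b"
    using card_diff_graph_verts[of a b f] V iv by (simp add: card_image)
  have f_le: "f i \<le> b" if "i \<in> {1..a}" for i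
    using f that by (auto simp: diff_fun_def Pi_def)
  have "snd (lab z) \<le> a + b" if "z \<in> pverts ?D" for z
    using that f_le by (fastforce simp: diff_graph_def lab_def)
  moreover have "(z, z') \<in> parcs ?D \<longleftrightarrow> label_adj (lab z) (lab z')"
    if "z \<in> pverts ?D" "z' \<in> pverts ?D" for z z'
    using that by (auto simp: diff_graph_def lab_def label_adj_def)
  ultimately show ?thesis
    using that[of "lab \<circ> ?v"] V arcs_iff card by (metis comp_apply imageI)
qed

text \<open>Ensures that every member of a cover is seen by some vertex, so that vertex
  multiplicities bound the size of the cover.\<close>

lemma difference_graph_verts_nonempty:
  assumes "is_difference_graph H"
  shows "pverts H \<noteq> {}"
proof -
  obtain a b f h where "a \<ge> 1" "with_proj (diff_graph a b f) = app_iso h (with_proj H)"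
    using assms by (auto simp: is_difference_graph_def digraph_iso_def)
  then have "a \<ge> 1" "pverts (diff_graph a b f) = iso_verts h ` pverts H"
    by (auto simp: with_proj_def app_iso_def)
  then show ?thesis by (auto simp: diff_graph_def)
qed

section \<open>Encoding and counting graphs that have a cover of small multiplicity\<close>

text \<open>A set of at most \<open>k\<close> elements is listed as a word of length exactly
  \<open>k\<close>, padded with the extra letter \<open>None\<close>; there are
  \<open>(card T + 1) ^ k\<close> such words.\<close>

lemma card_small_subsets_le:
  assumes "finite T"
  shows "finite {S. S \<subseteq> T \<and> card S \<le> k}" "card {S. S \<subseteq> T \<and> card S \<le> k} \<le> (card T + 1) ^ k"
proof -
  let ?L = "{xs. set xs \<subseteq> insert None (Some ` T) \<and> length xs = k}"
  have sub: "{S. S \<subseteq> T \<and> card S \<le> k} \<subseteq> (\<lambda>xs. the ` (set xs - {None})) ` ?L"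
  proof
    fix S assume S: "S \<in> {S. S \<subseteq> T \<and> card S \<le> k}"
    then obtain ys where ys: "set ys = S" "distinct ys"
      using assms finite_distinct_list finite_subset by blast
    have "length ys \<le> k" using S ys distinct_card by fastforce
    moreover have "S = the ` (set (map Some ys @ replicate (k - length ys) None) - {None})"
      using ys by (force simp: set_replicate_conv_if)
    ultimately show "S \<in> (\<lambda>xs. the ` (set xs - {None})) ` ?L"
      using S ys
      by (intro image_eqI[where x = "map Some ys @ replicate (k - length ys) None"])
        (auto simp: set_replicate_conv_if)
  qed
  have "card (insert None (Some ` T)) = card T + 1"
    using assms by (subst card_insert_disjoint) (auto simp: card_image)
  then have L: "finite ?L" "card ?L = (card T + 1) ^ k"
    using assms by (simp_all add: finite_lists_length_eq card_lists_length_eq)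
  show "finite {S. S \<subseteq> T \<and> card S \<le> k}"
    by (rule finite_subset[OF sub finite_imageI[OF L(1)]])
  show "card {S. S \<subseteq> T \<and> card S \<le> k} \<le> (card T + 1) ^ k"
    using surj_card_le[OF L(1) sub] L(2) by simp
qed

lemma difference_graph_cover_finite:
  assumes "pair_graph G" "difference_graph_cover G \<H>"
  shows "finite \<H>"
proof -
  interpret pair_graph G by fact
  have "\<H> \<subseteq> (\<lambda>(A, B). \<lparr>pverts = A, parcs = B\<rparr>) ` (Pow (pverts G) \<times> Pow (parcs G))"
  proof
    fix H assume "H \<in> \<H>"
    then have "pverts H \<subseteq> pverts G" "parcs H \<subseteq> parcs G"
      using assms(2) by (auto simp: difference_graph_cover_def subgraph_def)
    then show "H \<in> (\<lambda>(A, B). \<lparr>pverts = A, parcs = B\<rparr>) ` (Pow (pverts G) \<times> Pow (parcs G))"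
      by (intro image_eqI[where x = "(pverts H, parcs H)"]) auto
  qed
  then show ?thesis
    using finite_subset by fastforce
qed

text \<open>An incidence \<open>(i, p)\<close> in \<open>S v\<close> records that \<open>v\<close> has label \<open>p\<close> in the \<open>i\<close>-th member of a
  cover.\<close>

definition decode :: "'a set \<Rightarrow> ('a \<Rightarrow> (nat \<times> bool \<times> nat) set) \<Rightarrow> 'a pair_pre_digraph" where
  "decode V S = \<lparr> pverts = V,
     parcs = {(x, y). x \<in> V \<and> y \<in> V \<and> (\<exists>i p q. (i, p) \<in> S x \<and> (i, q) \<in> S y \<and> label_adj p q)} \<rparr>"

text \<open>Each vertex lies in at most \<open>k\<close> members and no member is empty, so
  \<open>n * k\<close> names suffice. The set of codes depends only on the vertex set and
  \<open>k\<close>, which lets it count all such graphs at once.\<close>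

lemma difference_graph_cover_encoding:
  assumes G: "pair_graph G" and cover: "difference_graph_cover G \<H>"
    and k: "\<And>v. v \<in> pverts G \<Longrightarrow> card {H \<in> \<H>. v \<in> pverts H} \<le> k"
  defines "n \<equiv> card (pverts G)"
  shows "G \<in> decode (pverts G) `
    (pverts G \<rightarrow>\<^sub>E {S. S \<subseteq> {..<n * k} \<times> UNIV \<times> {..n} \<and> card S \<le> k})"
proof -
  interpret pair_graph G by fact
  have fin: "finite \<H>" by (rule difference_graph_cover_finite[OF G cover])
  have diff: "is_difference_graph H" and sub: "pverts H \<subseteq> pverts G" "parcs H \<subseteq> parcs G"
    if "H \<in> \<H>" for H
    using cover that by (auto simp: difference_graph_cover_def subgraph_def)
  have wf: "x \<in> pverts H" "y \<in> pverts H" if "H \<in> \<H>" "(x, y) \<in> parcs H" for H x y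
  proof -
    interpret H: pair_graph H by (rule pair_graph_difference_graph[OF diff[OF that(1)]])
    show "x \<in> pverts H" "y \<in> pverts H"
      by (rule H.wellformed'[OF that(2)])+
  qed
  have "\<H> = (\<Union>v\<in>pverts G. {H \<in> \<H>. v \<in> pverts H})"
    using sub(1) difference_graph_verts_nonempty[OF diff] by fast
  then have "card \<H> \<le> (\<Sum>v\<in>pverts G. card {H \<in> \<H>. v \<in> pverts H})"
    using card_UN_le[of "pverts G" "\<lambda>v. {H \<in> \<H>. v \<in> pverts H}"] pair_finite_verts by simp
  also have "\<dots> \<le> n * k"
    unfolding n_def using sum_bounded_above[of "pverts G" _ k] k by simp
  finally have card_cover: "card \<H> \<le> n * k" .
  obtain idx where idx: "bij_betw idx \<H> {..<card \<H>}"
    using ex_bij_betw_finite_nat[OF fin] by (auto simp: atLeast0LessThan)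
  have "\<exists>s. (\<forall>x\<in>pverts H. snd (s x) \<le> n) \<and>
      (\<forall>x\<in>pverts H. \<forall>y\<in>pverts H. (x, y) \<in> parcs H \<longleftrightarrow> label_adj (s x) (s y))"
    if "H \<in> \<H>" for H
  proof -
    have "card (pverts H) \<le> n"
      unfolding n_def using sub(1)[OF that] by (intro card_mono) auto
    then show ?thesis
      using difference_graph_labelling[OF diff[OF that]] by (metis le_trans)
  qed
  then obtain s where s_le: "\<And>H x. H \<in> \<H> \<Longrightarrow> x \<in> pverts H \<Longrightarrow> snd (s H x) \<le> n"
    and s_adj: "\<And>H x y. H \<in> \<H> \<Longrightarrow> x \<in> pverts H \<Longrightarrow> y \<in> pverts H \<Longrightarrow>
      (x, y) \<in> parcs H \<longleftrightarrow> label_adj (s H x) (s H y)"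
    by metis
  \<comment> \<open>The restricted abstraction makes \<open>S\<close> extensional, as membership in
    the finite function space requires.\<close>
  define S where
    "S = (\<lambda>v\<in>pverts G. (\<lambda>H. (idx H, s H v)) ` {H \<in> \<H>. v \<in> pverts H})"
  have S_iff: "(i, p) \<in> S v \<longleftrightarrow> (\<exists>H\<in>\<H>. v \<in> pverts H \<and> i = idx H \<and> p = s H v)"
    if "v \<in> pverts G" for i p v
    using that by (auto simp: S_def)
  have "S v \<subseteq> {..<n * k} \<times> UNIV \<times> {..n} \<and> card (S v) \<le> k" if v: "v \<in> pverts G" for v
  proof
    have "idx H < n * k" if "H \<in> \<H>" for H
      using bij_betwE[OF idx] that card_cover by force
    then show "S v \<subseteq> {..<n * k} \<times> UNIV \<times> {..n}"
      using v s_le by (simp add: S_def image_subset_iff mem_Times_iff)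
    show "card (S v) \<le> k"
      using v k[OF v] card_image_le[of "{H \<in> \<H>. v \<in> pverts H}" "\<lambda>H. (idx H, s H v)"] fin
      by (simp add: S_def)
  qed
  moreover have "(x, y) \<in> parcs G \<longleftrightarrow> (\<exists>i p q. (i, p) \<in> S x \<and> (i, q) \<in> S y \<and> label_adj p q)"
    if "x \<in> pverts G" "y \<in> pverts G" for x y
  proof -
    have "(x, y) \<in> parcs G \<longleftrightarrow> (\<exists>H\<in>\<H>. (x, y) \<in> parcs H)"
      using cover by (auto simp: difference_graph_cover_def)
    also have "\<dots> \<longleftrightarrow>
        (\<exists>H\<in>\<H>. x \<in> pverts H \<and> y \<in> pverts H \<and> label_adj (s H x) (s H y))"
      using wf s_adj by blast
    \<comment> \<open>Since \<open>idx\<close> is injective, a shared name \<open>i\<close> forces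
      both labels to come from the same member.\<close>
    also have "\<dots> \<longleftrightarrow> (\<exists>i p q. (i, p) \<in> S x \<and> (i, q) \<in> S y \<and> label_adj p q)"
      using bij_betw_imp_inj_on[OF idx] unfolding S_iff[OF that(1)] S_iff[OF that(2)]
      by (metis inj_onD)
    finally show ?thesis .
  qed
  then have "(x, y) \<in> parcs G \<longleftrightarrow> (x, y) \<in> parcs (decode (pverts G) S)" for x y
    unfolding decode_def using wellformed'[of x y] by (simp del: split_paired_Ex) metis
  then have "parcs G = parcs (decode (pverts G) S)"
    by (intro set_eqI) (simp add: split_paired_all)
  then have "G = decode (pverts G) S"
    by (intro pair_pre_digraph.equality) (simp_all add: decode_def)
  moreover have "S \<in> extensional (pverts G)" by (simp add: S_def)
  ultimately show ?thesis
    by (intro image_eqI[where x = S]) (simp_all add: PiE_iff)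
qed

lemma card_graphs_with_local_cover_le:
  assumes V: "finite V"
    and G: "\<And>G. G \<in> \<G> \<Longrightarrow> pair_graph G \<and> pverts G = V \<and>
      (\<exists>\<H>. difference_graph_cover G \<H> \<and> (\<forall>v\<in>V. card {H \<in> \<H>. v \<in> pverts H} \<le> k))"
  shows "card \<G> \<le> (2 * (card V * k) * (card V + 1) + 1) ^ (card V * k)"
proof -
  let ?n = "card V"
  let ?T = "{..<?n * k} \<times> (UNIV :: bool set) \<times> {..?n}"
  let ?P = "V \<rightarrow>\<^sub>E {S. S \<subseteq> ?T \<and> card S \<le> k}"
  \<comment> \<open>Two sides, \<open>?n * k\<close> names, and the \<open>?n + 1\<close> numbers
    from 0 to \<open>?n\<close>.\<close>
  have T: "finite ?T" "card ?T = 2 * (?n * k) * (?n + 1)"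
    by (simp_all add: card_cartesian_product)
  note small = card_small_subsets_le[OF T(1), of k]
  have "\<G> \<subseteq> decode V ` ?P"
  proof
    fix G assume "G \<in> \<G>"
    with G obtain \<H> where "pair_graph G" "pverts G = V" "difference_graph_cover G \<H>"
      "\<And>v. v \<in> V \<Longrightarrow> card {H \<in> \<H>. v \<in> pverts H} \<le> k" by blast
    then show "G \<in> decode V ` ?P"
      using difference_graph_cover_encoding[of G \<H> k] by simp
  qed
  then have "card \<G> \<le> card ?P"
    using V small(1) by (intro surj_card_le finite_PiE) auto
  also have "\<dots> = card {S. S \<subseteq> ?T \<and> card S \<le> k} ^ ?n"
    using V by (simp add: card_PiE)
  also have "\<dots> \<le> ((card ?T + 1) ^ k) ^ ?n"
    using small(2) by (intro power_mono) auto
  also have "\<dots> = (2 * (?n * k) * (?n + 1) + 1) ^ (?n * k)"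
    unfolding T(2) by (simp only: power_mult[symmetric] mult.commute)
  finally show ?thesis .
qed

section \<open>Bipartite graphs between two fixed halves\<close>

definition bip_graph :: "'a set \<Rightarrow> ('a \<times> 'a) set \<Rightarrow> 'a pair_pre_digraph" where
  "bip_graph V E = \<lparr> pverts = V, parcs = E \<union> E\<inverse> \<rparr>"

lemma bip_graph_props:
  assumes "finite U" "finite W" "U \<inter> W = {}" "E \<subseteq> U \<times> W"
  shows "pair_graph (bip_graph (U \<union> W) E)" "bipartite (bip_graph (U \<union> W) E)"
proof -
  have "finite E" using assms finite_subset by blast
  then show "pair_graph (bip_graph (U \<union> W) E)"
    by unfold_locales (use assms in \<open>auto simp: bip_graph_def symmetric_def sym_def\<close>)
  show "bipartite (bip_graph (U \<union> W) E)"
    unfolding bipartite_def bip_graph_def using assms by (intro exI[of _ U] exI[of _ W]) auto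
qed

text \<open>The arcs from \<open>U\<close> to \<open>W\<close> recover \<open>E\<close>, because the
  reversed arcs all run from \<open>W\<close> to \<open>U\<close>.\<close>

lemma inj_on_bip_graph:
  assumes "U \<inter> W = {}"
  shows "inj_on (bip_graph V) (Pow (U \<times> W))"
proof (rule inj_onI)
  fix E E' assume E: "E \<in> Pow (U \<times> W)" "E' \<in> Pow (U \<times> W)" "bip_graph V E = bip_graph V E'"
  have "E = (E \<union> E\<inverse>) \<inter> U \<times> W" "E' = (E' \<union> E'\<inverse>) \<inter> U \<times> W"
    using E assms by auto
  with E(3) show "E = E'" by (simp add: bip_graph_def)
qed

text \<open>Every set of pairs between the two halves of \<open>{..<n}\<close> gives a different
  bipartite graph, and by assumption all of them are among the graphs counted above.\<close>

lemma card_bipartite_with_local_cover_le: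
  fixes n k :: nat
  assumes "\<And>G :: nat pair_pre_digraph. pair_graph G \<Longrightarrow> bipartite G \<Longrightarrow> card (pverts G) = n \<Longrightarrow>
      \<exists>\<H>. difference_graph_cover G \<H> \<and> (\<forall>v\<in>pverts G. card {H \<in> \<H>. v \<in> pverts H} \<le> k)"
  shows "2 ^ ((n div 2) * (n - n div 2)) \<le> (2 * (n * k) * (n + 1) + 1) ^ (n * k)"
proof -
  let ?U = "{..<n div 2}" and ?W = "{n div 2..<n}"
  have UW: "?U \<inter> ?W = {}" "?U \<union> ?W = {..<n}" by auto
  have "2 ^ ((n div 2) * (n - n div 2)) = card (bip_graph {..<n} ` Pow (?U \<times> ?W))"
    by (simp add: card_image inj_on_bip_graph[OF UW(1)] card_Pow card_cartesian_product)
  also have "\<dots> \<le> (2 * (card {..<n} * k) * (card {..<n} + 1) + 1) ^ (card {..<n} * k)"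
  proof (rule card_graphs_with_local_cover_le)
    fix G assume "G \<in> bip_graph {..<n} ` Pow (?U \<times> ?W)"
    then obtain E where "E \<subseteq> ?U \<times> ?W" "G = bip_graph {..<n} E" by auto
    then have G: "pair_graph G" "bipartite G" "pverts G = {..<n}"
      using bip_graph_props[of ?U ?W E] UW by (simp_all add: bip_graph_def)
    then show "pair_graph G \<and> pverts G = {..<n} \<and> (\<exists>\<H>. difference_graph_cover G \<H> \<and>
        (\<forall>v\<in>{..<n}. card {H \<in> \<H>. v \<in> pverts H} \<le> k))"
      using assms[of G] by simp
  qed simp
  finally show ?thesis by simp
qed

section \<open>Numerical estimate and conclusion\<close>

text \<open>Taking logarithms gives \<open>n \<le> 40 * (k * ln n)\<close>, where 40 = 4 * 5 * 2:
  the exponent in \<open>n ^ 4\<close>, the loss in comparing \<open>n * n\<close> with the product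
  of the halves, and \<open>ln 2 \<ge> 1 / 2\<close>. The constant 50 leaves room for
  strictness.\<close>

lemma local_multiplicity_bound:
  fixes n k :: nat
  assumes n: "n \<ge> 3"
    and le: "2 ^ ((n div 2) * (n - n div 2)) \<le> (2 * (n * k) * (n + 1) + 1) ^ (n * k)"
  shows "real n / 50 < real k * ln (real n)"
proof (cases "k \<le> n")
  case True
  have "2 * (n * k) * (n + 1) + 1 \<le> 2 * (n * n) * (n + 1) + 1"
    using True by (intro add_mono mult_le_mono order_refl)
  also have "\<dots> \<le> n ^ 4"
  proof -
    \<comment> \<open>After this shift the inequality holds coefficient by coefficient in
      \<open>m\<close>; it fails at \<open>n = 2\<close>.\<close>
    obtain m where "n = m + 3" using n by (metis le_add_diff_inverse2)
    then show ?thesis by (simp add: eval_nat_numeral algebra_simps)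
  qed
  finally have "(2 * (n * k) * (n + 1) + 1) ^ (n * k) \<le> (n ^ 4) ^ (n * k)"
    by (rule power_mono) simp
  then have "2 ^ ((n div 2) * (n - n div 2)) \<le> n ^ (4 * (n * k))"
    using le unfolding power_mult[of n 4] by (rule order_trans[rotated])
  then have "ln (real (2 ^ ((n div 2) * (n - n div 2)))) \<le> ln (real (n ^ (4 * (n * k))))"
    using n by (subst ln_le_cancel_iff) (simp_all del: of_nat_power)
  then have ln_le: "real ((n div 2) * (n - n div 2)) * ln 2 \<le> 4 * (real n * real k) * ln (real n)"
    using n by (simp add: ln_realpow)
  \<comment> \<open>For odd \<open>n\<close> the product is \<open>(n * n - 1) / 4\<close>, so a
    factor 4 would just fail.\<close>
  have "n * n \<le> 5 * ((n div 2) * (n - n div 2))"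
  proof (cases "even n")
    case True
    then show ?thesis by (auto elim!: evenE)
  next
    case False
    then obtain m where "n = 2 * m + 1" by (auto elim!: oddE)
    moreover from this n have "m \<le> m * m" "m \<ge> 1" by auto
    ultimately show ?thesis by (simp add: algebra_simps)
  qed
  then have "real n * real n \<le> 5 * real ((n div 2) * (n - n div 2))"
    by (metis of_nat_le_iff of_nat_mult of_nat_numeral)
  moreover have "exp 1 \<le> (2::real) ^ 2" using exp_le by simp
  then have "1 \<le> ln ((2::real) ^ 2)" by (subst ln_ge_iff) simp_all
  then have "1 / 2 \<le> ln (2::real)" by (subst (asm) ln_realpow) simp_all
  then have "real ((n div 2) * (n - n div 2)) * (1 / 2) \<le> real ((n div 2) * (n - n div 2)) * ln 2"
    by (intro mult_left_mono) auto
  ultimately have "real n * real n \<le> 10 * (4 * (real n * real k) * ln (real n))"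
    using ln_le by linarith
  then have "real n * real n \<le> real n * (40 * (real k * ln (real n)))"
    by (simp add: algebra_simps)
  then have "real n \<le> 40 * (real k * ln (real n))"
    using n by simp
  then show ?thesis using n by simp
next
  case False
  \<comment> \<open>For \<open>k > n\<close> the claim is immediate, as
    \<open>ln n \<ge> 1\<close>.\<close>
  have "exp 1 \<le> real n" using n exp_le by linarith
  then have "1 \<le> ln (real n)" using n by (simp add: ln_ge_iff)
  then have "real k * 1 \<le> real k * ln (real n)" by (intro mult_left_mono) auto
  then show ?thesis using False by linarith
qed

theorem lemma4:
  shows "\<exists>c::real. c > 0 \<and> (\<exists>N::nat. \<forall>n\<ge>N. \<exists>G :: nat pair_pre_digraph.
    pair_graph G \<and> bipartite G \<and> card (pverts G) = n \<and>
    (\<forall>\<H>. difference_graph_cover G \<H> \<longrightarrow>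
      (\<exists>v \<in> pverts G. real (card {H \<in> \<H>. v \<in> pverts H}) \<ge> c * real n / ln (real n))))"
proof (intro exI[of _ "1 / 50"] conjI exI[of _ 3] allI impI)
  fix n :: nat assume n: "3 \<le> n"
  show "\<exists>G :: nat pair_pre_digraph. pair_graph G \<and> bipartite G \<and> card (pverts G) = n \<and>
    (\<forall>\<H>. difference_graph_cover G \<H> \<longrightarrow>
      (\<exists>v \<in> pverts G. real (card {H \<in> \<H>. v \<in> pverts H}) \<ge> 1 / 50 * real n / ln (real n)))"
    (is "\<exists>G. ?P G")
  proof (rule ccontr)
    let ?x = "1 / 50 * real n / ln (real n)"
    \<comment> \<open>Multiplicities are integers, so those below \<open>?x\<close> are at most its
      floor. This \<open>k\<close> satisfies \<open>k * ln n \<le> n / 50\<close>, against the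
      strict estimate above.\<close>
    define k where "k = nat \<lfloor>?x\<rfloor>"
    have ln_pos: "0 < ln (real n)" using n by simp
    then have "0 \<le> ?x" by simp
    then have "real k \<le> ?x" unfolding k_def by linarith
    assume neg: "\<nexists>G. ?P G"
    have "\<exists>\<H>. difference_graph_cover G \<H> \<and> (\<forall>v\<in>pverts G. card {H \<in> \<H>. v \<in> pverts H} \<le> k)"
      if G: "pair_graph G" "bipartite G" "card (pverts G) = n" for G :: "nat pair_pre_digraph"
    proof -
      have "\<not> ?P G" using neg by blast
      then obtain \<H> where \<H>: "difference_graph_cover G \<H>"
        "\<forall>v\<in>pverts G. real (card {H \<in> \<H>. v \<in> pverts H}) < ?x"
        using G by (auto simp: not_le)
      have "card {H \<in> \<H>. v \<in> pverts H} \<le> k" if "v \<in> pverts G" for v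
        unfolding k_def using \<H>(2) that by (intro le_nat_floor) force
      with \<H>(1) show ?thesis by blast
    qed
    then have "real n / 50 < real k * ln (real n)"
      by (intro local_multiplicity_bound n card_bipartite_with_local_cover_le)
    moreover have "real k * ln (real n) \<le> real n / 50"
      using \<open>real k \<le> ?x\<close> ln_pos by (simp add: field_simps)
    ultimately show False by simp
  qed
qed simp

end
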